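(* Let $G=(V,E)$ be a spatial graph, $p_1$ a point lying on an edge $(u_1,v_1)\in E$ at relative position $\ell_{p_1}=d_E(p_1,u_1)$, and $p_2$ a point lying on an edge $(u_2,v_2)\in E$ at relative position $\ell_{p_2}=d_E(p_2,u_2)$. Then: if $d_G(p_1,p_2)=+\infty$, $S(p_1,p_2)=0$; if $p_1$ and $p_2$ lie on the same edge, $S(p_1,p_2)=1$; otherwise, with $\lambda_{u_2},\lambda_{v_2}$ the break-even distances of $(u_1,v_1)$ for $u_2$ and $v_2$, and $\lambda^{(1)}_{p_1}=\frac{d_G(u_1,v_2)-d_G(u_1,u_2)+d_E(u_2,v_2)}{2}$, $\lambda^{(2)}_{p_1}=\frac{d_G(v_1,v_2)-d_G(u_1,u_2)+d_E(u_1,v_1)+d_E(u_2,v_2)-2\ell_{p_1}}{2}$, $\lambda^{(3)}_{p_1}=\frac{d_G(u_1,v_2)-d_G(v_1,u_2)-d_E(u_1,v_1)+d_E(u_2,v_2)+2\ell_{p_1}}{2}$, $\lambda^{(4)}_{p_1}=\frac{d_G(v_1,v_2)-d_G(v_1,u_2)+d_E(u_2,v_2)}{2}$, \[ S(p_1,p_2)=\begin{cases} f_{u_1u_2}(\ell_{p_1},\ell_{p_2}), & \text{if } (\ell_{p_1}\le\lambda_{u_2},\lambda_{v_2}\wedge \ell_{p_2}\le\lambda^{(1)}_{p_1})\vee(\lambda_{v_2}<\ell_{p_1}\le\lambda_{u_2}\wedge\ell_{p_2}\le\lambda^{(2)}_{p_1}),\\ f_{u_1v_2}(\ell_{p_1},\ell_{p_2}),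 & \text{if } (\ell_{p_1}\le\lambda_{u_2},\lambda_{v_2}\wedge \ell_{p_2}>\lambda^{(1)}_{p_1})\vee(\lambda_{u_2}<\ell_{p_1}\le\lambda_{v_2}\wedge\ell_{p_2}>\lambda^{(3)}_{p_1}),\\ f_{v_1u_2}(\ell_{p_1},\ell_{p_2}), & \text{if } (\lambda_{u_2}<\ell_{p_1}\le\lambda_{v_2}\wedge \ell_{p_2}\le\lambda^{(3)}_{p_1})\vee(\ell_{p_1}>\lambda_{u_2},\lambda_{v_2}\wedge\ell_{p_2}\le\lambda^{(4)}_{p_1}),\\ f_{v_1v_2}(\ell_{p_1},\ell_{p_2}), & \text{if } (\lambda_{v_2}<\ell_{p_1}\le\lambda_{u_2}\wedge \ell_{p_2}>\lambda^{(2)}_{p_1})\vee(\ell_{p_1}>\lambda_{u_2},\lambda_{v_2}\wedge\ell_{p_2}>\lambda^{(4)}_{p_1}), \end{cases} \] where "$\ell_{p_1}\le\lambda_{u_2},\lambda_{v_2}$" means $\ell_{p_1}$ is $\le$ both, and similarly for $>$.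
   Context: A spatial graph $G=(V,E)$ is an undirected graph in which each vertex has a position in the Euclidean plane; each edge is the straight segment between its two end-vertices, written as a lexicographically ordered pair $(u,v)$. The graph points are the vertices together with all points lying on edges; a non-vertex point lies on exactly one edge. $d_E$ is the Euclidean distance. A path between two graph points is a sequence of adjacent segments along the edges (the first/last segment may be a portion of an edge); the graph distance $d_G$ is the length of a shortest such path ($+\infty$ if none). For a point $p$ on edge $(u,v)$, $\ell_p=d_E(p,u)$. Straightness: $S(p_1,p_2)=0$ if $d_G(p_1,p_2)=+\infty$, $S(p_1,p_2)=1$ if $p_1=p_2$, and $S(p_1,p_2)=d_E(p_1,p_2)/d_G(p_1,p_2)$ otherwise. Break-even distance: for a graph point $p$ not lying on edge $(u,v)$ or equal to one of its end-vertices, it is the number $\lambda_p$ with $d_G(p,u)+\lambda_p=d_G(p,v)+d_E(u,v)-\lambda_p$; for a vertex $r$, $\lambda_r=(d_G(r,v)-d_G(r,u)+d_E(u,v))/2$. Auxiliary functions: with $f(\ell_{p_1},\ell_{p_2};\alpha,\beta,\gamma)=d_E(p_1,p_2)/(\alpha+\beta\ell_{p_1}+\gamma\ell_{p_2})$ (the numerator written in terms of $\ell_{p_1},\ell_{p_2}$ via the vertex coordinates), set $f_{u_1u_2}=f(\cdot,\cdot;d_G(u_1,u_2),1,1)$, $f_{u_1v_2}=f(\cdot,\cdot;d_G(u_1,v_2)+d_E(u_2,v_2),1,-1)$, $f_{v_1u_2}=f(\cdot,\cdot;d_E(u_1,v_1)+d_G(v_1,u_2),-1,1)$, $f_{v_1v_2}=f(\cdot,\cdot;d_E(u_1,v_1)+d_G(v_1,v_2)+d_E(u_2,v_2),-1,-1)$.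 *)

theory Defs
  imports "HOL-Analysis.Analysis"
begin

(* Each undirected edge is stored once, as an ordered pair.  A lexicographic order of the
   vertices yields one such choice of pairs; any other choice is admitted as well. *)
record 'v spatial_graph =
  verts :: "'v set"
  edges :: "('v \<times> 'v) set"
  vpos :: "'v \<Rightarrow> real^2"

definition wf_spatial_graph :: "'v spatial_graph \<Rightarrow> bool" where
  "wf_spatial_graph G \<longleftrightarrow>
     edges G \<subseteq> verts G \<times> verts G \<and>
     (\<forall>u v. (u, v) \<in> edges G \<longrightarrow> (v, u) \<notin> edges G) \<and>
     (\<forall>u v. (u, v) \<in> edges G \<longrightarrow> vpos G u \<noteq> vpos G v)"

(* A non-vertex point records the unique edge it belongs to together with the fraction
   of that edge, strictly between 0 and 1, lying between its first end-vertex and the point.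
   Hence edges may cross in the plane: at a crossing there is one graph point per edge. *)
datatype 'v gpoint = Vertex 'v | Inner "'v \<times> 'v" real

fun loc :: "'v spatial_graph \<Rightarrow> 'v gpoint \<Rightarrow> real^2" where
  "loc G (Vertex v) = vpos G v"
| "loc G (Inner (u, v) s) = (1 - s) *\<^sub>R vpos G u + s *\<^sub>R vpos G v"

definition lies_on :: "'v spatial_graph \<Rightarrow> 'v gpoint \<Rightarrow> 'v \<times> 'v \<Rightarrow> bool" where
  "lies_on G p e \<longleftrightarrow> e \<in> edges G \<and>
     (p = Vertex (fst e) \<or> p = Vertex (snd e) \<or> (\<exists>s. 0 < s \<and> s < 1 \<and> p = Inner e s))"

definition graph_points :: "'v spatial_graph \<Rightarrow> 'v gpoint set" where
  "graph_points G = Vertex ` verts G \<union> {p. \<exists>e\<in>edges G. lies_on G p e}"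

definition same_edge :: "'v spatial_graph \<Rightarrow> 'v gpoint \<Rightarrow> 'v gpoint \<Rightarrow> bool" where
  "same_edge G p q \<longleftrightarrow> (\<exists>e\<in>edges G. lies_on G p e \<and> lies_on G q e)"

definition dE :: "'v spatial_graph \<Rightarrow> 'v gpoint \<Rightarrow> 'v gpoint \<Rightarrow> real" where
  "dE G p q = dist (loc G p) (loc G q)"

(* A path is given by the list of end-points of its successive segments.  All points other
   than the two extremities are vertices, so that only the first and the last segment can be
   proper portions of an edge.  A singleton list is the path of length 0. *)
definition is_gpath :: "'v spatial_graph \<Rightarrow> 'v gpoint \<Rightarrow> 'v gpoint list \<Rightarrow> 'v gpoint \<Rightarrow> bool" where
  "is_gpath G p ps q \<longleftrightarrow> ps \<noteq> [] \<and> hd ps = p \<and> last ps = q \<and>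
     set ps \<subseteq> graph_points G \<and>
     set (butlast (tl ps)) \<subseteq> Vertex ` verts G \<and>
     successively (same_edge G) ps"

definition gpath_length :: "'v spatial_graph \<Rightarrow> 'v gpoint list \<Rightarrow> real" where
  "gpath_length G ps = sum_list (map2 (dE G) ps (tl ps))"

(* The infimum of the empty set is infinity, covering the case where no path exists.
   In a finite graph the infimum is attained by a shortest path. *)
definition dG :: "'v spatial_graph \<Rightarrow> 'v gpoint \<Rightarrow> 'v gpoint \<Rightarrow> ereal" where
  "dG G p q = (INF ps \<in> {ps. is_gpath G p ps q}. ereal (gpath_length G ps))"

definition straightness :: "'v spatial_graph \<Rightarrow> 'v gpoint \<Rightarrow> 'v gpoint \<Rightarrow> real" where
  "straightness G p q =
     (if dG G p q = \<infinity> then 0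
      else if p = q then 1
      else dE G p q / real_of_ereal (dG G p q))"

definition break_even :: "'v spatial_graph \<Rightarrow> 'v \<times> 'v \<Rightarrow> 'v gpoint \<Rightarrow> real" where
  "break_even G e p = (THE l.
     dG G p (Vertex (fst e)) + ereal l =
     dG G p (Vertex (snd e)) + ereal (dE G (Vertex (fst e)) (Vertex (snd e))) - ereal l)"

(* Distances between vertices as real numbers; only meaningful when the distance is finite. *)
definition vdist :: "'v spatial_graph \<Rightarrow> 'v \<Rightarrow> 'v \<Rightarrow> real" where
  "vdist G u v = real_of_ereal (dG G (Vertex u) (Vertex v))"

definition edge_length :: "'v spatial_graph \<Rightarrow> 'v \<times> 'v \<Rightarrow> real" where
  "edge_length G e = dE G (Vertex (fst e)) (Vertex (snd e))"

(* The point of the plane at Euclidean distance l from the first end-vertex of the edge. *)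
definition edge_loc :: "'v spatial_graph \<Rightarrow> 'v \<times> 'v \<Rightarrow> real \<Rightarrow> real^2" where
  "edge_loc G e l =
     vpos G (fst e) + (l / edge_length G e) *\<^sub>R (vpos G (snd e) - vpos G (fst e))"

definition f_aux ::
  "'v spatial_graph \<Rightarrow> 'v \<times> 'v \<Rightarrow> 'v \<times> 'v \<Rightarrow> real \<Rightarrow> real \<Rightarrow> real \<Rightarrow> real \<Rightarrow> real \<Rightarrow> real" where
  "f_aux G e1 e2 \<alpha> \<beta> \<gamma> l1 l2 =
     dist (edge_loc G e1 l1) (edge_loc G e2 l2) / (\<alpha> + \<beta> * l1 + \<gamma> * l2)"

definition f_uu :: "'v spatial_graph \<Rightarrow> 'v \<times> 'v \<Rightarrow> 'v \<times> 'v \<Rightarrow> real \<Rightarrow> real \<Rightarrow> real" where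
  "f_uu G e1 e2 = f_aux G e1 e2 (vdist G (fst e1) (fst e2)) 1 1"

definition f_uv :: "'v spatial_graph \<Rightarrow> 'v \<times> 'v \<Rightarrow> 'v \<times> 'v \<Rightarrow> real \<Rightarrow> real \<Rightarrow> real" where
  "f_uv G e1 e2 = f_aux G e1 e2 (vdist G (fst e1) (snd e2) + edge_length G e2) 1 (-1)"

definition f_vu :: "'v spatial_graph \<Rightarrow> 'v \<times> 'v \<Rightarrow> 'v \<times> 'v \<Rightarrow> real \<Rightarrow> real \<Rightarrow> real" where
  "f_vu G e1 e2 = f_aux G e1 e2 (edge_length G e1 + vdist G (snd e1) (fst e2)) (-1) 1"

definition f_vv :: "'v spatial_graph \<Rightarrow> 'v \<times> 'v \<Rightarrow> 'v \<times> 'v \<Rightarrow> real \<Rightarrow> real \<Rightarrow> real" where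
  "f_vv G e1 e2 =
     f_aux G e1 e2 (edge_length G e1 + vdist G (snd e1) (snd e2) + edge_length G e2) (-1) (-1)"

lemma gpath_length_nonneg: "gpath_length G ps \<ge> 0"
  unfolding gpath_length_def dE_def by (rule sum_list_nonneg) auto

lemma dG_nonneg: "dG G p q \<ge> 0"
  unfolding dG_def by (rule INF_greatest) (simp add: gpath_length_nonneg)

lemma break_even_vertex:
  assumes "dG G (Vertex r) (Vertex u) \<noteq> \<infinity>" and "dG G (Vertex r) (Vertex v) \<noteq> \<infinity>"
  shows "break_even G (u, v) (Vertex r) = (vdist G r v - vdist G r u + edge_length G (u, v)) / 2"
proof -
  obtain a where a: "dG G (Vertex r) (Vertex u) = ereal a"
    using assms(1) dG_nonneg[of G "Vertex r" "Vertex u"]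
    by (cases "dG G (Vertex r) (Vertex u)") auto
  obtain b where b: "dG G (Vertex r) (Vertex v) = ereal b"
    using assms(2) dG_nonneg[of G "Vertex r" "Vertex v"]
    by (cases "dG G (Vertex r) (Vertex v)") auto
  show ?thesis
    unfolding break_even_def vdist_def edge_length_def a b fst_conv snd_conv
    by (rule the_equality) (auto simp: field_simps)
qed

lemma loc_eq_edge_loc:
  assumes "wf_spatial_graph G" and "lies_on G p (u, v)"
  shows "loc G p = edge_loc G (u, v) (dE G p (Vertex u))"
proof -
  have uv: "vpos G u \<noteq> vpos G v"
    using assms by (auto simp: wf_spatial_graph_def lies_on_def)
  from assms(2) consider "p = Vertex u" | "p = Vertex v"
    | s where "0 < s" "s < 1" "p = Inner (u, v) s"
    by (auto simp: lies_on_def)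
  then show ?thesis
  proof cases
    case 3
    have "loc G p - vpos G u = s *\<^sub>R (vpos G v - vpos G u)"
      using 3 by (simp add: algebra_simps)
    then have "dE G p (Vertex u) = s * dist (vpos G u) (vpos G v)"
      using 3 by (simp add: dE_def dist_norm norm_minus_commute)
    then show ?thesis
      using 3 uv by (simp add: edge_loc_def edge_length_def dE_def algebra_simps)
  qed (use uv in \<open>auto simp: edge_loc_def edge_length_def dE_def dist_commute\<close>)
qed

end

(* A path that leaves the edge of its starting point p does so through one of the two
   end-vertices u, v of that edge, so d_G(p, q) is the smaller of d_E(p, u) + d_G(u, q) and
   d_E(p, v) + d_G(v, q).  Applied to both extremities, this makes d_G(p1, p2) the minimum of
   four numbers, one per pair of end-vertices; these are the denominators of the four
   auxiliary functions.  Every inequality in the case distinction compares two of them. *)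
theory Submission
  imports Defs
begin

section \<open>Path length, path reversal and symmetry of the graph distance\<close>

lemma gpath_length_simps [simp]:
  "gpath_length G [] = 0"
  "gpath_length G [p] = 0"
  "gpath_length G (p # q # ps) = dE G p q + gpath_length G (q # ps)"
  by (simp_all add: gpath_length_def)

lemma gpath_length_snoc:
  "gpath_length G (ps @ [p, q]) = gpath_length G (ps @ [p]) + dE G p q"
proof (induction ps)
  case (Cons a ps)
  then show ?case by (cases ps) auto
qed simp

lemma dE_commute: "dE G p q = dE G q p"
  by (simp add: dE_def dist_commute)

lemma dE_self [simp]: "dE G p p = 0"
  by (simp add: dE_def)

lemma gpath_length_rev: "gpath_length G (rev ps) = gpath_length G ps"
proof (induction ps)
  case (Cons a ps)
  then show ?case
    by (cases ps) (auto simp: gpath_length_snoc dE_commute)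
qed simp

lemma same_edge_commute: "same_edge G p q \<longleftrightarrow> same_edge G q p"
  by (auto simp: same_edge_def)

lemma is_gpath_rev:
  assumes "is_gpath G p ps q"
  shows "is_gpath G q (rev ps) p"
proof -
  \<comment> \<open>Removing both extremities commutes with reversal, so the requirement that
    interior points be vertices carries over.\<close>
  have "butlast (tl (rev ps)) = rev (butlast (tl ps))"
    by (metis butlast_rev butlast_tl rev_rev_ident)
  moreover have "successively (same_edge G) (rev ps)"
    using assms same_edge_commute[of G]
    by (simp add: is_gpath_def successively_rev)
  ultimately show ?thesis
    using assms by (auto simp: is_gpath_def hd_rev last_rev)
qed

lemma dG_le: "is_gpath G p ps q \<Longrightarrow> dG G p q \<le> ereal (gpath_length G ps)"
  unfolding dG_def by (rule INF_lower) simp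

text \<open>Reversal turns paths from \<open>q\<close> to \<open>p\<close> into equally long paths
  from \<open>p\<close> to \<open>q\<close>; one inequality for arbitrary points therefore
  suffices.\<close>

lemma dG_commute: "dG G p q = dG G q p"
proof -
  have "dG G p q \<le> dG G q p" for p q
    by (subst (2) dG_def, rule INF_greatest)
      (metis dG_le gpath_length_rev is_gpath_rev mem_Collect_eq)
  then show ?thesis by (simp add: antisym)
qed

section \<open>Graph distance against Euclidean distance\<close>

lemma dE_le_gpath_length:
  "ps \<noteq> [] \<Longrightarrow> dE G (hd ps) (last ps) \<le> gpath_length G ps"
proof (induction ps rule: induct_list012)
  case (3 p q ps)
  then have "dE G q (last (q # ps)) \<le> gpath_length G (q # ps)"
    by simp
  moreover have "dE G p (last (q # ps)) \<le> dE G p q + dE G q (last (q # ps))"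
    unfolding dE_def by (rule dist_triangle)
  ultimately show ?case by simp
qed simp_all

lemma dE_le_dG: "ereal (dE G p q) \<le> dG G p q"
  unfolding dG_def
  by (rule INF_greatest) (auto simp: is_gpath_def dest: dE_le_gpath_length)

text \<open>The path with a single segment attains the Euclidean lower bound.\<close>

lemma dG_same_edge:
  assumes "same_edge G p q"
  shows "dG G p q = ereal (dE G p q)"
proof (rule antisym)
  have "is_gpath G p [p, q] q"
    using assms by (auto simp: is_gpath_def same_edge_def graph_points_def)
  from dG_le[OF this] show "dG G p q \<le> ereal (dE G p q)" by simp
qed (rule dE_le_dG)

section \<open>Leaving an edge through one of its end-vertices\<close>

lemma lies_on_fst: "(u, v) \<in> edges G \<Longrightarrow> lies_on G (Vertex u) (u, v)"
  and lies_on_snd: "(u, v) \<in> edges G \<Longrightarrow> lies_on G (Vertex v) (u, v)"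
  by (simp_all add: lies_on_def)

lemma lies_on_same_edge: "lies_on G p e \<Longrightarrow> lies_on G q e \<Longrightarrow> same_edge G p q"
  by (auto simp: same_edge_def lies_on_def)

text \<open>Putting \<open>p\<close> in front of a path that starts at \<open>w\<close> gives a path
  again: \<open>w\<close> may become an interior point because it is a vertex.\<close>

lemma dG_le_step:
  assumes "wf_spatial_graph G" and "same_edge G p (Vertex w)"
  shows "dG G p q \<le> ereal (dE G p (Vertex w)) + dG G (Vertex w) q"
proof -
  \<comment> \<open>With the finite summand moved to the left, the infimum stands alone on the right
    and can be bounded path by path.\<close>
  have "dG G p q - ereal (dE G p (Vertex w)) \<le> dG G (Vertex w) q"
    unfolding dG_def[of G "Vertex w"]
  proof (rule INF_greatest, clarify)
    fix ps assume ps: "is_gpath G (Vertex w) ps q"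
    then obtain qs where qs: "ps = Vertex w # qs"
      by (cases ps) (auto simp: is_gpath_def)
    have "w \<in> verts G"
      using assms by (auto simp: wf_spatial_graph_def same_edge_def lies_on_def)
    moreover have "p \<in> graph_points G"
      using assms by (auto simp: same_edge_def graph_points_def)
    ultimately have "is_gpath G p (p # ps) q"
      using ps assms(2) unfolding qs is_gpath_def by auto
    from dG_le[OF this] show "dG G p q - ereal (dE G p (Vertex w)) \<le> ereal (gpath_length G ps)"
      by (simp add: qs ereal_minus_le_iff add.commute)
  qed
  then show ?thesis
    by (simp add: ereal_minus_le_iff add.commute)
qed

text \<open>The condition on \<open>q\<close> rules out a direct segment that ends inside the edge
  of \<open>p\<close>. A vertex \<open>q\<close> is allowed even on a common edge, since the second
  extremity is later treated with an arbitrary vertex as target.\<close>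

lemma dG_via_end_vertices:
  assumes wf: "wf_spatial_graph G" and p: "lies_on G p (u, v)"
    and q: "\<not> same_edge G p q \<or> q \<in> range Vertex"
  shows "dG G p q = min (ereal (dE G p (Vertex u)) + dG G (Vertex u) q)
                        (ereal (dE G p (Vertex v)) + dG G (Vertex v) q)"
    (is "_ = min ?U ?V")
proof (rule antisym)
  have uv: "(u, v) \<in> edges G" using p by (simp add: lies_on_def)
  have "same_edge G p (Vertex u)" "same_edge G p (Vertex v)"
    using lies_on_same_edge[OF p] lies_on_fst[OF uv] lies_on_snd[OF uv] by auto
  then show "dG G p q \<le> min ?U ?V"
    by (simp add: dG_le_step[OF wf])
  show "min ?U ?V \<le> dG G p q"
  proof (cases "p = Vertex u \<or> p = Vertex v")
    case True
    \<comment> \<open>One of the two terms is then \<open>0\<close> plus the distance from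
      \<open>p\<close> itself.\<close>
    then show ?thesis by (auto simp: zero_ereal_def[symmetric])
  next
    case False
    \<comment> \<open>Being no end-vertex, \<open>p\<close> is an \<open>Inner\<close> point, and
      its constructor fixes the only edge it lies on.\<close>
    then have ends: "w = u \<or> w = v" if "same_edge G p (Vertex w)" for w
      using p that by (auto simp: same_edge_def lies_on_def)
    show ?thesis
    proof (cases "same_edge G p q")
      case True
      then obtain w where w: "q = Vertex w" "w = u \<or> w = v" using q ends by auto
      have "dG G (Vertex w) (Vertex w) = 0"
        using dG_same_edge[of G "Vertex w" "Vertex w"] True w
        by (auto simp: same_edge_def zero_ereal_def)
      then show ?thesis using w True by (auto simp: dG_same_edge min_le_iff_disj)
    next
      case sep: False
      show ?thesis
        unfolding dG_def[of G p]
      proof (rule INF_greatest, clarify)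
        fix ps assume ps: "is_gpath G p ps q"
        moreover have "\<not> is_gpath G p [p] q"
          using sep lies_on_same_edge[OF p p] by (auto simp: is_gpath_def)
        moreover have "\<not> is_gpath G p [p, r] q" for r
          using sep by (auto simp: is_gpath_def)
        moreover have "ps \<noteq> []" "hd ps = p"
          using ps by (auto simp: is_gpath_def)
        \<comment> \<open>With at most two points on the path, \<open>p\<close> and \<open>q\<close>
          would share an edge. So there is a third point \<open>s\<close>, which makes
          \<open>r\<close> interior to the path and hence a vertex.\<close>
        ultimately obtain r s qs where qs: "ps = p # r # s # qs"
          by (metis list.exhaust_sel)
        then obtain w where w: "r = Vertex w" using ps by (auto simp: is_gpath_def)
        have "is_gpath G r (r # s # qs) q"
          using ps by (auto simp: is_gpath_def qs)
        then have "dG G r q \<le> ereal (gpath_length G (r # s # qs))" by (rule dG_le)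
        then have "ereal (dE G p r) + dG G r q
            \<le> ereal (dE G p r) + ereal (gpath_length G (r # s # qs))"
          by (rule add_left_mono)
        then have "ereal (dE G p r) + dG G r q \<le> ereal (gpath_length G ps)"
          by (simp add: qs)
        moreover have "w = u \<or> w = v"
          using ps w by (intro ends) (auto simp: is_gpath_def qs)
        ultimately show "min ?U ?V \<le> ereal (gpath_length G ps)"
          using w by (auto simp: min_le_iff_disj)
      qed
    qed
  qed
qed

section \<open>Distances along a single edge\<close>

lemma dE_snd_eq:
  assumes "wf_spatial_graph G" and "lies_on G p (u, v)"
  shows "dE G p (Vertex v) = edge_length G (u, v) - dE G p (Vertex u)"
proof -
  from assms(2) consider "p = Vertex u" | "p = Vertex v"
    | s where "0 < s" "s < 1" "p = Inner (u, v) s"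
    by (auto simp: lies_on_def)
  then show ?thesis
  proof cases
    case 3
    have "loc G p - vpos G u = s *\<^sub>R (vpos G v - vpos G u)"
      "loc G p - vpos G v = (1 - s) *\<^sub>R (vpos G u - vpos G v)"
      using 3 by (simp_all add: algebra_simps)
    then have "dE G p (Vertex u) = s * dist (vpos G u) (vpos G v)"
      "dE G p (Vertex v) = (1 - s) * dist (vpos G u) (vpos G v)"
      using 3 by (simp_all add: dE_def dist_norm norm_minus_commute)
    then show ?thesis
      by (simp add: edge_length_def dE_def algebra_simps)
  qed (auto simp: edge_length_def dE_def dist_commute)
qed

text \<open>Ensures that straightness on a common edge is a quotient of equal positive numbers and
  not \<open>0 / 0\<close>.\<close>

lemma same_edge_dE_pos:
  assumes wf: "wf_spatial_graph G" and "same_edge G p q" and "p \<noteq> q"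
  shows "dE G p q > 0"
proof -
  obtain u v where e: "lies_on G p (u, v)" "lies_on G q (u, v)"
    using assms(2) by (auto simp: same_edge_def)
  then have ne: "vpos G u \<noteq> vpos G v"
    using wf by (auto simp: wf_spatial_graph_def lies_on_def)
  \<comment> \<open>Every point of the edge is determined by its parameter \<open>s\<close>, with
    \<open>0\<close> and \<open>1\<close> for the end-vertices. As the end-vertices have distinct
    positions, equal locations force equal parameters and so equal points.\<close>
  have "\<exists>s. loc G r = vpos G u + s *\<^sub>R (vpos G v - vpos G u) \<and>
      r = (if s = 0 then Vertex u else if s = 1 then Vertex v else Inner (u, v) s)"
    if r: "lies_on G r (u, v)" for r
  proof -
    from r consider "r = Vertex u" | "r = Vertex v"
      | s where "0 < s" "s < 1" "r = Inner (u, v) s"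
      by (auto simp: lies_on_def)
    then show ?thesis
    proof cases
      case 1
      then show ?thesis by (intro exI[of _ 0]) simp
    next
      case 2
      then show ?thesis by (intro exI[of _ 1]) simp
    next
      case 3
      then show ?thesis by (intro exI[of _ s]) (simp add: algebra_simps)
    qed
  qed
  from this[OF e(1)] this[OF e(2)] have "loc G p \<noteq> loc G q"
    using ne \<open>p \<noteq> q\<close> by auto
  then show ?thesis by (simp add: dE_def)
qed

lemma straightness_same_edge:
  assumes "wf_spatial_graph G" and "same_edge G p q"
  shows "straightness G p q = 1"
  using same_edge_dE_pos[OF assms] dG_same_edge[OF assms(2)]
  by (cases "p = q") (auto simp: straightness_def)

section \<open>Reduction to four distances between end-vertices\<close>

lemma dG_infinite_edge_iff:
  assumes wf: "wf_spatial_graph G" and uv: "(u, v) \<in> edges G"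
  shows "dG G (Vertex u) q = \<infinity> \<longleftrightarrow> dG G (Vertex v) q = \<infinity>"
proof -
  \<comment> \<open>The edge has finite length, so a finite distance from one end gives a finite
    distance from the other.\<close>
  have "same_edge G (Vertex u) (Vertex v)"
    using lies_on_same_edge[OF lies_on_fst[OF uv] lies_on_snd[OF uv]] .
  then show ?thesis
    using dG_le_step[OF wf, of "Vertex u" v q] dG_le_step[OF wf, of "Vertex v" u q]
    by (auto simp: same_edge_commute)
qed

text \<open>Leaving through an end-vertex is applied at both extremities. Finiteness comes first,
  because \<open>vdist\<close> represents \<open>dG\<close> only where it is finite.\<close>

lemma
  assumes wf: "wf_spatial_graph G"
    and p1: "lies_on G p1 (u1, v1)" and p2: "lies_on G p2 (u2, v2)"
    and sep: "\<not> same_edge G p1 p2" and fin: "dG G p1 p2 \<noteq> \<infinity>"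
  shows dG_end_vertices_finite:
      "\<And>a b. a \<in> {u1, v1} \<Longrightarrow> b \<in> {u2, v2} \<Longrightarrow> dG G (Vertex a) (Vertex b) = ereal (vdist G a b)"
    and dG_end_vertices:
      "dG G p1 p2 = ereal (Min ((\<lambda>(a, b).
          dE G p1 (Vertex a) + vdist G a b + dE G p2 (Vertex b)) ` ({u1, v1} \<times> {u2, v2})))"
proof -
  have e1: "(u1, v1) \<in> edges G" and e2: "(u2, v2) \<in> edges G"
    using p1 p2 by (simp_all add: lies_on_def)
  \<comment> \<open>The target \<open>Vertex a\<close> may lie on the edge of \<open>p2\<close>,
    which is where the vertex alternative of \<open>dG_via_end_vertices\<close> is used.\<close>
  have p2_eq: "dG G (Vertex a) p2 =
      min (ereal (dE G p2 (Vertex u2)) + dG G (Vertex a) (Vertex u2))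
          (ereal (dE G p2 (Vertex v2)) + dG G (Vertex a) (Vertex v2))" for a
    using dG_via_end_vertices[OF wf p2, of "Vertex a"] by (simp add: dG_commute)
  note eq = dG_via_end_vertices[OF wf p1 disjI1[OF sep], unfolded p2_eq]
  have "dG G (Vertex a) (Vertex b) \<noteq> \<infinity>" if "a \<in> {u1, v1}" "b \<in> {u2, v2}" for a b
  proof
    assume inf: "dG G (Vertex a) (Vertex b) = \<infinity>"
    \<comment> \<open>Infinity spreads across each of the two edges, so one infinite distance makes
      all four infinite and \<open>dG G p1 p2\<close> with them.\<close>
    have step1: "dG G (Vertex u1) (Vertex r) = \<infinity> \<longleftrightarrow> dG G (Vertex v1) (Vertex r) = \<infinity>" for r
      by (rule dG_infinite_edge_iff[OF wf e1])
    have step2: "dG G (Vertex r) (Vertex u2) = \<infinity> \<longleftrightarrow> dG G (Vertex r) (Vertex v2) = \<infinity>" for r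
      using dG_infinite_edge_iff[OF wf e2, of "Vertex r"] by (simp add: dG_commute)
    have "dG G (Vertex u1) (Vertex u2) = \<infinity>" "dG G (Vertex u1) (Vertex v2) = \<infinity>"
      "dG G (Vertex v1) (Vertex u2) = \<infinity>" "dG G (Vertex v1) (Vertex v2) = \<infinity>"
      using inf that step1 step2 by auto
    then show False using eq fin by simp
  qed
  then show real: "dG G (Vertex a) (Vertex b) = ereal (vdist G a b)"
    if "a \<in> {u1, v1}" "b \<in> {u2, v2}" for a b
    using that dG_nonneg[of G "Vertex a" "Vertex b"]
    by (cases "dG G (Vertex a) (Vertex b)") (auto simp: vdist_def)
  have "{u1, v1} \<times> {u2, v2} = {(u1, u2), (u1, v2), (v1, u2), (v1, v2)}" by auto
  then show "dG G p1 p2 = ereal (Min ((\<lambda>(a, b).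
      dE G p1 (Vertex a) + vdist G a b + dE G p2 (Vertex b)) ` ({u1, v1} \<times> {u2, v2})))"
    unfolding eq by (simp add: real min_def algebra_simps)
qed

section \<open>The case distinction for straightness\<close>

theorem theorem1:
  fixes G :: "'v spatial_graph"
    and p1 p2 :: "'v gpoint"
    and u1 v1 u2 v2 :: 'v
    and l1 l2 :: real
  assumes "wf_spatial_graph G"
    and "(u1, v1) \<in> edges G" and "lies_on G p1 (u1, v1)" and "l1 = dE G p1 (Vertex u1)"
    and "(u2, v2) \<in> edges G" and "lies_on G p2 (u2, v2)" and "l2 = dE G p2 (Vertex u2)"
  shows "(dG G p1 p2 = \<infinity> \<longrightarrow> straightness G p1 p2 = 0) \<and>
    (same_edge G p1 p2 \<longrightarrow> straightness G p1 p2 = 1) \<and>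
    (dG G p1 p2 \<noteq> \<infinity> \<and> \<not> same_edge G p1 p2 \<longrightarrow>
      (let e1 = (u1, v1);
           e2 = (u2, v2);
           lamu = break_even G e1 (Vertex u2);
           lamv = break_even G e1 (Vertex v2);
           lam1 = (vdist G u1 v2 - vdist G u1 u2 + edge_length G e2) / 2;
           lam2 = (vdist G v1 v2 - vdist G u1 u2 + edge_length G e1 + edge_length G e2 - 2 * l1) / 2;
           lam3 = (vdist G u1 v2 - vdist G v1 u2 - edge_length G e1 + edge_length G e2 + 2 * l1) / 2;
           lam4 = (vdist G v1 v2 - vdist G v1 u2 + edge_length G e2) / 2
       in
         ((l1 \<le> lamu \<and> l1 \<le> lamv \<and> l2 \<le> lam1) \<or> (lamv < l1 \<and> l1 \<le> lamu \<and> l2 \<le> lam2)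
           \<longrightarrow> straightness G p1 p2 = f_uu G e1 e2 l1 l2) \<and>
         ((l1 \<le> lamu \<and> l1 \<le> lamv \<and> l2 > lam1) \<or> (lamu < l1 \<and> l1 \<le> lamv \<and> l2 > lam3)
           \<longrightarrow> straightness G p1 p2 = f_uv G e1 e2 l1 l2) \<and>
         ((lamu < l1 \<and> l1 \<le> lamv \<and> l2 \<le> lam3) \<or> (l1 > lamu \<and> l1 > lamv \<and> l2 \<le> lam4)
           \<longrightarrow> straightness G p1 p2 = f_vu G e1 e2 l1 l2) \<and>
         ((lamv < l1 \<and> l1 \<le> lamu \<and> l2 > lam2) \<or> (l1 > lamu \<and> l1 > lamv \<and> l2 > lam4)
           \<longrightarrow> straightness G p1 p2 = f_vv G e1 e2 l1 l2)))"
proof -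
  note wf = assms(1) and p1 = assms(3) and p2 = assms(6)
  define L1 where "L1 = edge_length G (u1, v1)"
  define L2 where "L2 = edge_length G (u2, v2)"
  show ?thesis
  proof (intro conjI impI)
    show "straightness G p1 p2 = 0" if "dG G p1 p2 = \<infinity>"
      using that by (simp add: straightness_def)
    show "straightness G p1 p2 = 1" if "same_edge G p1 p2"
      using straightness_same_edge[OF wf that] .
  next
    assume "dG G p1 p2 \<noteq> \<infinity> \<and> \<not> same_edge G p1 p2"
    then have fin: "dG G p1 p2 \<noteq> \<infinity>" and sep: "\<not> same_edge G p1 p2" by auto
    \<comment> \<open>Any point on an edge shares that edge with itself, so the clause of
      \<open>straightness\<close> for equal points does not apply.\<close>
    have ne: "p1 \<noteq> p2" using sep lies_on_same_edge[OF p1 p1] by auto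
    note real = dG_end_vertices_finite[OF wf p1 p2 sep fin]
    \<comment> \<open>Break-even distances are measured from \<open>u2\<close> and
      \<open>v2\<close>, whereas the formula measures from \<open>u1\<close> and
      \<open>v1\<close>.\<close>
    have sym: "vdist G a b = vdist G b a" for a b
      by (simp add: vdist_def dG_commute)
    have lamu: "break_even G (u1, v1) (Vertex u2) = (vdist G v1 u2 - vdist G u1 u2 + L1) / 2"
      unfolding L1_def sym[of _ u2]
      by (rule break_even_vertex) (simp_all add: dG_commute[of G "Vertex u2"] real)
    have lamv: "break_even G (u1, v1) (Vertex v2) = (vdist G v1 v2 - vdist G u1 v2 + L1) / 2"
      unfolding L1_def sym[of _ v2]
      by (rule break_even_vertex) (simp_all add: dG_commute[of G "Vertex v2"] real)
    have ends: "dE G p1 (Vertex u1) = l1" "dE G p1 (Vertex v1) = L1 - l1"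
      "dE G p2 (Vertex u2) = l2" "dE G p2 (Vertex v2) = L2 - l2"
      using dE_snd_eq[OF wf p1] dE_snd_eq[OF wf p2] assms(4,7)
      by (simp_all add: L1_def L2_def)
    have prod: "{u1, v1} \<times> {u2, v2} = {(u1, u2), (u1, v2), (v1, u2), (v1, v2)}" by auto
    have "real_of_ereal (dG G p1 p2) =
        min (l1 + vdist G u1 u2 + l2) (min (l1 + vdist G u1 v2 + (L2 - l2))
          (min (L1 - l1 + vdist G v1 u2 + l2) (L1 - l1 + vdist G v1 v2 + (L2 - l2))))"
      by (simp add: dG_end_vertices[OF wf p1 p2 sep fin] prod ends del: ereal_min)
    moreover have "dE G p1 p2 = dist (edge_loc G (u1, v1) l1) (edge_loc G (u2, v2) l2)"
      using loc_eq_edge_loc[OF wf p1] loc_eq_edge_loc[OF wf p2] assms(4,7)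
      by (simp add: dE_def)
    \<comment> \<open>Keeping \<open>D\<close> free lets \<open>S\<close> match each auxiliary
      function; what remains is that its denominator is the minimum.\<close>
    ultimately have S: "straightness G p1 p2 =
        dist (edge_loc G (u1, v1) l1) (edge_loc G (u2, v2) l2) / D"
      if "D = min (l1 + vdist G u1 u2 + l2) (min (l1 + vdist G u1 v2 + (L2 - l2))
          (min (L1 - l1 + vdist G v1 u2 + l2) (L1 - l1 + vdist G v1 v2 + (L2 - l2))))" for D
      using that fin ne by (simp add: straightness_def)
    show "let e1 = (u1, v1);
           e2 = (u2, v2);
           lamu = break_even G e1 (Vertex u2);
           lamv = break_even G e1 (Vertex v2);
           lam1 = (vdist G u1 v2 - vdist G u1 u2 + edge_length G e2) / 2;
           lam2 = (vdist G v1 v2 - vdist G u1 u2 + edge_length G e1 + edge_length G e2 - 2 * l1) / 2;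
           lam3 = (vdist G u1 v2 - vdist G v1 u2 - edge_length G e1 + edge_length G e2 + 2 * l1) / 2;
           lam4 = (vdist G v1 v2 - vdist G v1 u2 + edge_length G e2) / 2
       in
         ((l1 \<le> lamu \<and> l1 \<le> lamv \<and> l2 \<le> lam1) \<or> (lamv < l1 \<and> l1 \<le> lamu \<and> l2 \<le> lam2)
           \<longrightarrow> straightness G p1 p2 = f_uu G e1 e2 l1 l2) \<and>
         ((l1 \<le> lamu \<and> l1 \<le> lamv \<and> l2 > lam1) \<or> (lamu < l1 \<and> l1 \<le> lamv \<and> l2 > lam3)
           \<longrightarrow> straightness G p1 p2 = f_uv G e1 e2 l1 l2) \<and>
         ((lamu < l1 \<and> l1 \<le> lamv \<and> l2 \<le> lam3) \<or> (l1 > lamu \<and> l1 > lamv \<and> l2 \<le> lam4)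
           \<longrightarrow> straightness G p1 p2 = f_vu G e1 e2 l1 l2) \<and>
         ((lamv < l1 \<and> l1 \<le> lamu \<and> l2 > lam2) \<or> (l1 > lamu \<and> l1 > lamv \<and> l2 > lam4)
           \<longrightarrow> straightness G p1 p2 = f_vv G e1 e2 l1 l2)"
      \<comment> \<open>Write \<open>uu\<close>, \<open>uv\<close>, \<open>vu\<close>,
        \<open>vv\<close> for the four denominators. Then \<open>l1 \<le> lamu\<close> means
        \<open>uu \<le> vu\<close>, and \<open>l1 \<le> lamv\<close> means
        \<open>uv \<le> vv\<close>. This leaves two candidates, and the bound on \<open>l2\<close>
        decides between them: \<open>lam1\<close> compares \<open>uu\<close> with \<open>uv\<close>,
        \<open>lam2\<close> compares \<open>uu\<close> with \<open>vv\<close>, \<open>lam3\<close>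
        compares \<open>vu\<close> with \<open>uv\<close>, and \<open>lam4\<close> compares
        \<open>vu\<close> with \<open>vv\<close>.\<close>
      unfolding Let_def lamu lamv f_uu_def f_uv_def f_vu_def f_vv_def f_aux_def
        L1_def[symmetric] L2_def[symmetric]
      by (intro conjI impI S; argo?) (auto simp: min_def field_simps)
  qed
qed

end
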